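(* For complex $\beta,x,z$, $$\sum_{n=0}^{\infty}\frac{\Gamma(n\beta+1)\,\bigl(x(x+1)^{-\beta}\bigr)^n\;{}_1F_1(-n;\,\beta n-n+1;\,-z)}{n!\,\Gamma(\beta n-n+1)}=-\frac{(x+1)e^{xz}}{\beta x-x-1}.$$
   Context: $\Gamma$ is the Euler gamma function and ${}_1F_1(a;b;z)=\sum_{k\ge0}\frac{(a)_k}{(b)_k\,k!}z^k$ is the Kummer confluent hypergeometric function, with $(a)_k=a(a+1)\cdots(a+k-1)$.
   Formalization: x is restricted to the component of 0 of the set where x(x+1)^{-β} lies in the open disc of convergence (x≠-1, off the principal cut unless β is an integer), as the identity fails e.g. at β=2, z=0, x=4; terms undefined through Gamma poles are read as limits in β. *)

theory Defs
  imports "HOL-Complex_Analysis.Complex_Analysis"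
begin

definition kummer_1F1 :: "complex \<Rightarrow> complex \<Rightarrow> complex \<Rightarrow> complex" where
  "kummer_1F1 a b z = (\<Sum>k. pochhammer a k / (pochhammer b k * fact k) * z ^ k)"

text \<open>The coefficient of $w^n$, $w = x(x+1)^{-\beta}$, exactly as it is written in the series.\<close>

definition kummer_coeff_raw :: "complex \<Rightarrow> complex \<Rightarrow> nat \<Rightarrow> complex" where
  "kummer_coeff_raw \<beta> z n =
     Gamma (of_nat n * \<beta> + 1) * kummer_1F1 (- of_nat n) (\<beta> * of_nat n - of_nat n + 1) (- z)
       / (fact n * Gamma (\<beta> * of_nat n - of_nat n + 1))"

text \<open>For some rational $\beta < 1$ the expression above involves a pole of $\Gamma$ or a
  lower parameter of ${}_1F_1$ in $\{0,-1,-2,\ldots\}$, where the library's total functions return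
  junk values. These singularities in $\beta$ are removable; the coefficient is then read as
  the limiting value.\<close>

definition kummer_coeff :: "complex \<Rightarrow> complex \<Rightarrow> nat \<Rightarrow> complex" where
  "kummer_coeff \<beta> z n =
     (if of_nat n * \<beta> + 1 \<notin> \<int>\<^sub>\<le>\<^sub>0 \<and> \<beta> * of_nat n - of_nat n + 1 \<notin> \<int>\<^sub>\<le>\<^sub>0
      then kummer_coeff_raw \<beta> z n
      else Lim (at \<beta>) (\<lambda>b. kummer_coeff_raw b z n))"

text \<open>The identity cannot hold for all complex $x$: the series is a power series in
  $w = x(x+1)^{-\beta}$, which may diverge, and $x \mapsto w$ is not injective
  (for $\beta = 2$, both $x$ and $1/x$ give the same $w$). The admissible $x$ are those that can be
  joined to $0$ within the set where $w$ lies in the open disc of convergence, staying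
  away from $-1$ and, unless $\beta$ is an integer, from the cut of the principal power.\<close>

definition kummer_domain :: "complex \<Rightarrow> complex \<Rightarrow> complex set" where
  "kummer_domain \<beta> z =
     connected_component_set
       {x. x \<noteq> -1 \<and> (\<beta> \<in> \<int> \<or> x + 1 \<notin> \<real>\<^sub>\<le>\<^sub>0) \<and>
           ereal (norm (x * (x + 1) powr (- \<beta>))) < conv_radius (kummer_coeff \<beta> z)} 0"

end

theory Submission
  imports Defs
begin

text \<open>The $n$-th coefficient is $[t^n]\, e^{tz} (1+t)^{n\beta}$, so near $0$ the identity is
  Lagrange's expansion in powers of $w = x/\varphi(x)$ with $\varphi(t) = (1+t)^\beta$. The expansion
  comes from a geometric series under Cauchy's integral over a circle around $0$ on which
  $|g(x)/g(u)| \le 1/2$, where $g(t) = t/\varphi(t)$ is injective on a larger disc. It extends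
  to the whole component in the form
  $F(w(x))\,(\beta x - x - 1) = -(x+1)e^{xz}$; as the right-hand side has no zero there,
  neither has $\beta x - x - 1$.\<close>

section \<open>Lagrange's expansion by contour integration\<close>

text \<open>The difference quotient of \<open>g\<close> at \<open>x\<close>, completed by
  \<open>deriv g x\<close>, is holomorphic, and by injectivity it has no zeros. Dividing
  \<open>h\<close> by it turns the integrand into one for Cauchy's integral formula.\<close>

lemma has_contour_integral_inverse_injective:
  assumes "open S" "cball 0 r \<subseteq> S" "x \<in> ball 0 r"
    and g: "g holomorphic_on S" "inj_on g S" and h: "h holomorphic_on S"
  shows "((\<lambda>u. h u / (g u - g x)) has_contour_integral 2 * of_real pi * \<i> * (h x / deriv g x))
           (circlepath 0 r)"
proof -
  define q where "q = (\<lambda>u. if u = x then deriv g x else (g u - g x) / (u - x))"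
  have x: "x \<in> S"
    using assms by auto
  have "q holomorphic_on S"
    unfolding q_def using g(1) \<open>open S\<close> x by (intro pole_lemma) (auto simp: interior_open)
  moreover have "q u \<noteq> 0" if "u \<in> S" for u
    using holomorphic_injective_imp_regular[OF g(1) \<open>open S\<close> g(2)] that x inj_onD[OF g(2)]
    by (auto simp: q_def)
  ultimately have "(\<lambda>u. h u / q u) holomorphic_on cball 0 r"
    using h \<open>cball 0 r \<subseteq> S\<close> by (intro holomorphic_on_divide) (auto intro: holomorphic_on_subset)
  then have "((\<lambda>u. h u / q u / (u - x)) has_contour_integral 2 * of_real pi * \<i> * (h x / q x))
               (circlepath 0 r)"
    using \<open>x \<in> ball 0 r\<close> by (intro Cauchy_integral_circlepath_simple) auto
  then show ?thesis
  \<comment> \<open>The rule exchanges the integrand on the circle; \<open>back_subst\<close> leaves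
    the equality of the two integral values as a final goal.\<close>
  proof (rule has_contour_integral_eq[THEN back_subst[where P="\<lambda>c. (_ has_contour_integral c) _"]])
    fix u assume "u \<in> path_image (circlepath 0 r)"
    then have "u \<noteq> x"
      using \<open>x \<in> ball 0 r\<close> by (auto simp: path_image_circlepath)
    then show "h u / q u / (u - x) = h u / (g u - g x)"
      by (simp add: q_def)
  qed (simp add: q_def)
qed

text \<open>With \<open>g t = t / \<phi> t\<close>, the right-hand side is
  \<open>f x / \<phi> x / deriv g x\<close>, a Cauchy integral with kernel
  \<open>1 / (g u - g x)\<close>. Expanding the kernel in powers of \<open>g x / g u\<close> and
  integrating termwise gives the derivatives at 0.\<close>

theorem Lagrange_inversion:
  fixes f \<phi> :: "complex \<Rightarrow> complex"
  assumes "open S" "0 \<in> S" "f holomorphic_on S" "\<phi> holomorphic_on S" "\<phi> 0 \<noteq> 0"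
  shows "\<forall>\<^sub>F x in nhds 0. (\<lambda>n. (deriv ^^ n) (\<lambda>t. f t * \<phi> t ^ n) 0 / fact n * (x / \<phi> x) ^ n) sums
           (f x * \<phi> x / (\<phi> x - x * deriv \<phi> x))"
proof -
  define g where "g = (\<lambda>t. t / \<phi> t)"
  obtain R where R: "R > 0" "ball 0 R \<subseteq> S" "\<And>t. t \<in> ball 0 R \<Longrightarrow> \<phi> t \<noteq> 0"
  proof -
    have "continuous (at 0) \<phi>"
      using assms by (meson continuous_on_eq_continuous_at holomorphic_on_imp_continuous_on)
    then have "\<forall>\<^sub>F t in nhds 0. \<phi> t \<noteq> 0 \<and> t \<in> S"
      using assms eventually_nhds_in_open[of S 0]
      by (intro eventually_conj) (auto simp: isCont_def tendsto_at_iff_tendsto_nhds intro: tendsto_imp_eventually_ne)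
    then show ?thesis
      using that unfolding eventually_nhds_metric by (auto simp: subset_iff dist_commute)
  qed
  have hol: "\<phi> holomorphic_on ball 0 R" "f holomorphic_on ball 0 R"
    using assms R by (auto intro: holomorphic_on_subset)
  have dg: "(g has_field_derivative (\<phi> t - t * deriv \<phi> t) / (\<phi> t)\<^sup>2) (at t)" if "t \<in> ball 0 R" for t
    unfolding g_def using R(3)[OF that] holomorphic_derivI[OF hol(1) open_ball that]
    by (auto intro!: derivative_eq_intros simp: power2_eq_square field_simps)
  have "g holomorphic_on ball 0 R"
    unfolding g_def using R hol by (intro holomorphic_intros) auto
  moreover have "0 \<in> ball (0::complex) R"
    using R by simp
  \<comment> \<open>The value is \<open>1 / \<phi> 0\<close>, so \<open>g\<close> is injective near
    0.\<close>
  moreover have "deriv g 0 \<noteq> 0"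
    using DERIV_imp_deriv[OF dg[of 0]] R by auto
  ultimately obtain s where s: "s > 0" "ball 0 s \<subseteq> ball (0::complex) R" "inj_on g (ball 0 s)"
    by (rule has_complex_derivative_locally_injective[OF _ _ open_ball])
  have nz: "\<phi> t \<noteq> 0" if "norm t < s" for t
    using R(3) s(2) that by (auto simp: subset_iff)
  have hol': "\<phi> holomorphic_on ball 0 s" "f holomorphic_on ball 0 s" "g holomorphic_on ball 0 s"
    using hol \<open>g holomorphic_on ball 0 R\<close> s by (auto intro: holomorphic_on_subset)
  define r where "r = s / 2"
  have r: "0 < r" "r < s"
    using s by (auto simp: r_def)
  then have sub: "cball 0 r \<subseteq> ball (0::complex) s" "sphere 0 r \<subseteq> ball (0::complex) s"
    by auto
  note cont = hol'(2,3)[THEN holomorphic_on_subset, OF sub(2), THEN holomorphic_on_imp_continuous_on]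
  have g_nz: "g u \<noteq> 0" if "norm u = r" for u
    using that r nz[of u] by (auto simp: g_def)
  have "compact (f ` sphere 0 r)"
    by (intro compact_continuous_image cont(1) compact_sphere)
  then obtain M where M: "M > 0" "\<And>u. norm u = r \<Longrightarrow> norm (f u) \<le> M"
    by (auto dest!: compact_imp_bounded simp: bounded_pos)
  \<comment> \<open>The minimum of \<open>norm (g u)\<close> on the circle; requiring
    \<open>norm (g x) < m / 2\<close> then makes the geometric ratio at most 1/2.\<close>
  obtain m where m: "m > 0" "\<And>u. norm u = r \<Longrightarrow> m \<le> norm (g u)"
  proof -
    have "of_real r \<in> sphere (0::complex) r"
      using r by auto
    then have "\<exists>u\<in>sphere 0 r. \<forall>v\<in>sphere 0 r. norm (g u) \<le> norm (g v)"
      by (intro continuous_attains_inf continuous_on_norm cont(2) compact_sphere) blast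
    then obtain u where u: "norm u = r" "\<And>v. norm v = r \<Longrightarrow> norm (g u) \<le> norm (g v)"
      by auto
    then show ?thesis
      using that[of "norm (g u)"] g_nz by auto
  qed
  have "\<forall>\<^sub>F x in nhds 0. norm (g x) < m / 2 \<and> x \<in> ball 0 r"
  proof (intro eventually_conj eventually_nhds_in_open)
    have "isCont g 0"
      using R by (intro DERIV_isCont[OF dg]) auto
    then have "(\<lambda>x. norm (g x)) \<midarrow>0\<rightarrow> norm (g 0)"
      by (intro tendsto_norm) (simp add: isCont_def)
    then have "(\<lambda>x. norm (g x)) \<midarrow>0\<rightarrow> 0"
      by (simp add: g_def)
    then have "\<forall>\<^sub>F x in at 0. norm (g x) < m / 2"
      using m(1) by (intro order_tendstoD) auto
    then show "\<forall>\<^sub>F x in nhds 0. norm (g x) < m / 2"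
      using m(1) by (simp add: eventually_nhds_conv_at g_def)
  qed (use r in auto)
  then show ?thesis
  proof (rule eventually_mono, elim conjE)
    fix x assume gx: "norm (g x) < m / 2" and x: "x \<in> ball 0 r"
    define a where "a n = (deriv ^^ n) (\<lambda>t. f t * \<phi> t ^ n) 0 / fact n * g x ^ n" for n
    define L where "L = f x * \<phi> x / (\<phi> x - x * deriv \<phi> x)"
    have xR: "x \<in> ball 0 R"
      using x sub(1) s(2) ball_subset_cball by blast
    \<comment> \<open>This is the value given by the integral lemma for
      \<open>h = f / \<phi>\<close>.\<close>
    have "f x / \<phi> x / deriv g x = L"
      using DERIV_imp_deriv[OF dg[OF xR]] R(3)[OF xR] by (simp add: L_def power2_eq_square)
    moreover have "(\<lambda>u. f u / \<phi> u) holomorphic_on ball 0 s"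
      using hol' nz by (intro holomorphic_intros) auto
    ultimately have int_L: "((\<lambda>u. f u / \<phi> u / (g u - g x)) has_contour_integral 2 * of_real pi * \<i> * L)
        (circlepath 0 r)"
      using has_contour_integral_inverse_injective[OF open_ball sub(1) x hol'(3) s(3), of "\<lambda>u. f u / \<phi> u"]
      by simp
    \<comment> \<open>On the circle the integrand equals
      \<open>g x ^ n * f u * \<phi> u ^ n / u ^ Suc n\<close>, so Cauchy's formula for the
      \<open>n\<close>-th derivative applies.\<close>
    have int_a: "((\<lambda>u. f u / u * (g x / g u) ^ n) has_contour_integral 2 * of_real pi * \<i> * a n)
        (circlepath 0 r)" for n
    proof -
      have "(\<lambda>t. f t * \<phi> t ^ n) holomorphic_on ball 0 s"
        using hol' by (intro holomorphic_intros)
      then have "((\<lambda>u. f u * \<phi> u ^ n / (u - 0) ^ Suc n) has_contour_integral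
          2 * pi * \<i> / fact n * (deriv ^^ n) (\<lambda>t. f t * \<phi> t ^ n) 0) (circlepath 0 r)"
        using sub(1) r
        by (intro Cauchy_has_contour_integral_higher_derivative_circlepath)
           (auto elim!: holomorphic_on_subset intro!: holomorphic_on_imp_continuous_on)
      then have "((\<lambda>u. g x ^ n * (f u * \<phi> u ^ n / (u - 0) ^ Suc n)) has_contour_integral
          g x ^ n * (2 * pi * \<i> / fact n * (deriv ^^ n) (\<lambda>t. f t * \<phi> t ^ n) 0)) (circlepath 0 r)"
        by (rule has_contour_integral_lmul)
      moreover have "g x ^ n * (2 * pi * \<i> / fact n * (deriv ^^ n) (\<lambda>t. f t * \<phi> t ^ n) 0) =
          2 * of_real pi * \<i> * a n"
        by (simp add: a_def)
      ultimately show ?thesis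
        by (auto elim!: has_contour_integral_eq simp: g_def power_divide power_mult_distrib mult_ac)
    qed
    \<comment> \<open>The geometric remainder is
      \<open>f u / u * (\<rho> ^ N / (1 - \<rho>))\<close> with \<open>\<rho> = g x / g u\<close>.
      The factors are bounded by \<open>M / r\<close>, \<open>(1/2) ^ N\<close> and 2; the length
      \<open>2 * pi * r\<close> of the circle cancels \<open>r\<close> and the factor
      \<open>2 * pi\<close>.\<close>
    have bound: "norm (L - (\<Sum>n<N. a n)) \<le> 2 * M * (1/2) ^ N" for N
    proof -
      have "((\<lambda>u. f u / \<phi> u / (g u - g x) - (\<Sum>n<N. f u / u * (g x / g u) ^ n)) has_contour_integral
          2 * of_real pi * \<i> * L - (\<Sum>n<N. 2 * of_real pi * \<i> * a n)) (circlepath 0 r)"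
        by (intro has_contour_integral_diff int_L has_contour_integral_sum int_a) auto
      then have "norm (2 * of_real pi * \<i> * L - (\<Sum>n<N. 2 * of_real pi * \<i> * a n)) \<le>
          (2 * M / r * (1/2) ^ N) * (2 * pi * r)"
      proof (rule has_contour_integral_bound_circlepath)
        fix u :: complex assume "norm (u - 0) = r"
        then have u: "norm u = r" by simp
        define \<rho> where "\<rho> = g x / g u"
        have "norm \<rho> \<le> (m / 2) / m"
          unfolding \<rho>_def norm_divide using gx m(1) m(2)[OF u] by (intro frac_le) auto
        then have \<rho>: "norm \<rho> \<le> 1 / 2"
          using m(1) by simp
        have "norm (1 - \<rho>) \<ge> norm (1::complex) - norm \<rho>"
          by (rule norm_triangle_ineq2)
        then have \<rho>': "norm (1 - \<rho>) \<ge> 1 / 2" 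
          using \<rho> by simp
        then have "\<rho> \<noteq> 1"
          by auto
        have "f u / \<phi> u / (g u - g x) = f u / u / (1 - \<rho>)"
          using g_nz[OF u] u r nz[of u] by (auto simp: \<rho>_def g_def field_simps)
        moreover have "(\<Sum>n<N. f u / u * \<rho> ^ n) = f u / u * ((1 - \<rho> ^ N) / (1 - \<rho>))"
          using \<open>\<rho> \<noteq> 1\<close> by (simp only: sum_distrib_left[symmetric] sum_gp_strict if_False)
        moreover have "c / (1 - \<rho>) - c * ((1 - \<rho> ^ N) / (1 - \<rho>)) = c * (\<rho> ^ N / (1 - \<rho>))" for c
          by (simp add: diff_divide_distrib right_diff_distrib)
        ultimately have "f u / \<phi> u / (g u - g x) - (\<Sum>n<N. f u / u * (g x / g u) ^ n) =
            f u / u * (\<rho> ^ N / (1 - \<rho>))"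
          by (simp only: \<rho>_def[symmetric])
        also have "norm \<dots> \<le> M / r * ((1 / 2) ^ N / (1 / 2))"
          unfolding norm_mult norm_divide norm_power u
          using \<rho> \<rho>' M r u by (intro mult_mono frac_le power_mono) auto
        finally show "norm (f u / \<phi> u / (g u - g x) - (\<Sum>n<N. f u / u * (g x / g u) ^ n)) \<le>
            2 * M / r * (1/2) ^ N"
          by (simp add: mult_ac)
      qed (use M r in auto)
      moreover have "2 * of_real pi * \<i> * L - (\<Sum>n<N. 2 * of_real pi * \<i> * a n) =
          2 * of_real pi * \<i> * (L - (\<Sum>n<N. a n))"
        by (simp add: right_diff_distrib sum_distrib_left)
      ultimately have "2 * pi * norm (L - (\<Sum>n<N. a n)) \<le> 2 * pi * (2 * M * (1/2) ^ N)"
        using r by (simp add: norm_mult)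
      then show ?thesis
        by simp
    qed
    have "(\<lambda>N. 2 * M * (1/2::real) ^ N) \<longlonglongrightarrow> 2 * M * 0"
      by (intro tendsto_mult tendsto_const LIMSEQ_power_zero) simp
    then have "(\<lambda>N. L - (\<Sum>n<N. a n)) \<longlonglongrightarrow> 0"
      by (intro Lim_null_comparison[OF always_eventually[OF allI[OF bound]]]) simp
    then have "(\<lambda>N. L - (L - (\<Sum>n<N. a n))) \<longlonglongrightarrow> L - 0"
      by (intro tendsto_intros)
    then have "a sums L"
      by (simp add: sums_def)
    then show "(\<lambda>n. (deriv ^^ n) (\<lambda>t. f t * \<phi> t ^ n) 0 / fact n * (x / \<phi> x) ^ n) sums
        (f x * \<phi> x / (\<phi> x - x * deriv \<phi> x))"
      by (simp add: a_def[abs_def] L_def g_def)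
  qed
qed

section \<open>Closed form and continuity of the coefficients\<close>

lemma tendsto_gbinomial:
  fixes f :: "'b \<Rightarrow> 'a::real_normed_field"
  assumes "(f \<longlongrightarrow> a) F"
  shows "((\<lambda>x. f x gchoose k) \<longlongrightarrow> a gchoose k) F"
  unfolding gbinomial_prod_rev by (intro tendsto_intros assms) auto

text \<open>Every set of integers is closed, so the integers other than
  \<open>c * \<beta> + d\<close> stay away from that point, and \<open>c \<noteq> 0\<close> keeps
  \<open>c * b + d\<close> different from it when \<open>b \<noteq> \<beta>\<close>. This isolates
  the singular parameters.\<close>

lemma eventually_at_not_in_Ints:
  fixes c d \<beta> :: complex
  assumes "c \<noteq> 0"
  shows "\<forall>\<^sub>F b in at \<beta>. c * b + d \<notin> \<int>"
proof -
  have "\<forall>\<^sub>F x in at (c * \<beta> + d). x \<in> - (\<int> - {c * \<beta> + d}) - {c * \<beta> + d}"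
    by (intro eventually_at_in_open open_Compl closed_subset_Ints) auto
  moreover have "filterlim (\<lambda>b. c * b + d) (at (c * \<beta> + d)) (at \<beta>)"
    using assms by (auto simp: filterlim_at eventually_at_filter intro!: tendsto_intros)
  ultimately have "\<forall>\<^sub>F b in at \<beta>. c * b + d \<in> - (\<int> - {c * \<beta> + d}) - {c * \<beta> + d}"
    by (rule eventually_compose_filterlim)
  then show ?thesis
    by eventually_elim auto
qed

text \<open>The series terminates because \<open>pochhammer (- of_nat n) k\<close> vanishes for
  \<open>k > n\<close>; the signs of this factor and of \<open>(- z) ^ k\<close> cancel.\<close>

lemma kummer_1F1_neg_of_nat:
  "kummer_1F1 (- of_nat n) b (- z) =
     (\<Sum>k\<le>n. of_nat (n choose k) * z ^ k / pochhammer b k)"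
proof -
  have "kummer_1F1 (- of_nat n) b (- z) =
      (\<Sum>k\<le>n. pochhammer (- of_nat n) k / (pochhammer b k * fact k) * (- z) ^ k)"
    unfolding kummer_1F1_def by (intro suminf_finite) (auto simp: pochhammer_of_nat_eq_0_iff)
  moreover have "pochhammer (- of_nat n) k / (pochhammer b k * fact k) * (- z) ^ k =
      of_nat (n choose k) * z ^ k / pochhammer b k" for k
    by (simp add: binomial_gbinomial gbinomial_pochhammer power_minus[of z] mult_ac)
  ultimately show ?thesis
    by simp
qed

text \<open>Since \<open>pochhammer b k * Gamma b = Gamma (b + of_nat k)\<close>, the Gamma
  quotients combine into generalized binomials. The result is a polynomial in
  \<open>\<beta>\<close>, which is what makes the singularities removable.\<close>

lemma kummer_coeff_raw_eq:
  assumes "of_nat n * \<beta> + 1 \<notin> \<int>\<^sub>\<le>\<^sub>0" "\<beta> * of_nat n - of_nat n + 1 \<notin> \<int>\<^sub>\<le>\<^sub>0"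
  shows "kummer_coeff_raw \<beta> z n = (\<Sum>k\<le>n. z ^ k / fact k * (of_nat n * \<beta> gchoose (n - k)))"
proof -
  define b where "b = \<beta> * of_nat n - of_nat n + 1"
  have b: "b \<notin> \<int>\<^sub>\<le>\<^sub>0" "Gamma b \<noteq> 0"
    using assms by (simp_all add: b_def Gamma_eq_zero_iff)
  have "Gamma (of_nat n * \<beta> + 1) / (fact n * Gamma b) *
      (of_nat (n choose k) * z ^ k / pochhammer b k) =
      z ^ k / fact k * (of_nat n * \<beta> gchoose (n - k))" if "k \<le> n" for k
  proof -
    have "of_nat n * \<beta> - of_nat (n - k) + 1 = b + of_nat k"
      using that by (simp add: b_def of_nat_diff)
    then have "of_nat n * \<beta> gchoose (n - k) =
        Gamma (of_nat n * \<beta> + 1) / (fact (n - k) * Gamma (b + of_nat k))"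
      by (simp only: gbinomial_Gamma[OF assms(1)])
    then show ?thesis
      using b that by (simp add: pochhammer_Gamma binomial_fact mult_ac)
  qed
  then have "(\<Sum>k\<le>n. z ^ k / fact k * (of_nat n * \<beta> gchoose (n - k))) =
      Gamma (of_nat n * \<beta> + 1) / (fact n * Gamma b) *
      (\<Sum>k\<le>n. of_nat (n choose k) * z ^ k / pochhammer b k)"
    unfolding sum_distrib_left by (intro sum.cong) auto
  then show ?thesis
    by (simp add: kummer_coeff_raw_def kummer_1F1_neg_of_nat b_def)
qed

lemma tendsto_kummer_coeff_raw:
  "((\<lambda>b. kummer_coeff_raw b z n) \<longlongrightarrow>
     (\<Sum>k\<le>n. z ^ k / fact k * (of_nat n * \<beta> gchoose (n - k)))) (at \<beta>)"
proof (rule Lim_transform_eventually)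
  show "((\<lambda>b. \<Sum>k\<le>n. z ^ k / fact k * (of_nat n * b gchoose (n - k))) \<longlongrightarrow>
     (\<Sum>k\<le>n. z ^ k / fact k * (of_nat n * \<beta> gchoose (n - k)))) (at \<beta>)"
    by (intro tendsto_intros tendsto_gbinomial)
  have "\<forall>\<^sub>F b in at \<beta>. of_nat n * b + 1 \<notin> \<int>\<^sub>\<le>\<^sub>0 \<and> b * of_nat n - of_nat n + 1 \<notin> \<int>\<^sub>\<le>\<^sub>0"
  \<comment> \<open>For \<open>n = 0\<close> both arguments are constantly 1; otherwise they are
    nonconstant affine functions of \<open>b\<close>.\<close>
  proof (cases "n = 0")
    case False
    then have "\<forall>\<^sub>F b in at \<beta>. of_nat n * b + 1 \<notin> \<int> \<and> of_nat n * b + (1 - of_nat n) \<notin> \<int>"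
      by (intro eventually_conj eventually_at_not_in_Ints) auto
    then show ?thesis
      by eventually_elim (auto simp: algebra_simps dest: nonpos_Ints_subset_Ints[THEN subsetD])
  qed auto
  then show "\<forall>\<^sub>F b in at \<beta>. (\<Sum>k\<le>n. z ^ k / fact k * (of_nat n * b gchoose (n - k))) =
      kummer_coeff_raw b z n"
    by eventually_elim (simp add: kummer_coeff_raw_eq)
qed

text \<open>Both branches of the definition give the same polynomial, so from here on no exceptional
  \<open>\<beta>\<close> has to be singled out.\<close>

lemma kummer_coeff_eq:
  "kummer_coeff \<beta> z n = (\<Sum>k\<le>n. z ^ k / fact k * (of_nat n * \<beta> gchoose (n - k)))"
  using tendsto_Lim[OF _ tendsto_kummer_coeff_raw] by (auto simp: kummer_coeff_def kummer_coeff_raw_eq)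

text \<open>The closed form is a Cauchy product of the exponential and binomial series. Writing it
  as a derivative of \<open>f t * \<phi> t ^ n\<close> fits Lagrange's expansion.\<close>

lemma kummer_coeff_conv_deriv:
  "kummer_coeff \<beta> z n =
     (deriv ^^ n) (\<lambda>t. exp (t * z) * ((1 + t) powr \<beta>) ^ n) 0 / fact n"
proof -
  have "(\<lambda>t. exp (z * t) * (1 + t) powr (of_nat n * \<beta>)) has_fps_expansion
      fps_exp z * fps_binomial (of_nat n * \<beta>)"
    by (intro fps_expansion_intros)
  from fps_nth_fps_expansion[OF this, of n]
  have "kummer_coeff \<beta> z n = (deriv ^^ n) (\<lambda>t. exp (z * t) * (1 + t) powr (of_nat n * \<beta>)) 0 / fact n"
    by (simp add: kummer_coeff_eq fps_mult_nth atLeast0AtMost)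
  also have "(deriv ^^ n) (\<lambda>t. exp (z * t) * (1 + t) powr (of_nat n * \<beta>)) 0 =
      (deriv ^^ n) (\<lambda>t. exp (t * z) * ((1 + t) powr \<beta>) ^ n) 0"
  proof (rule higher_deriv_cong_ev)
    \<comment> \<open>At \<open>t = -1\<close> the equality fails for \<open>n = 0\<close>, because
      \<open>0 powr 0 = 0\<close> while a zeroth power is 1.\<close>
    have "\<forall>\<^sub>F t in nhds 0. t \<in> - {-1::complex}"
      by (intro eventually_nhds_in_open) auto
    then show "\<forall>\<^sub>F t in nhds 0. exp (z * t) * (1 + t) powr (of_nat n * \<beta>) =
        exp (t * z) * ((1 + t) powr \<beta>) ^ n"
    proof eventually_elim
      case (elim t)
      then have "1 + t \<noteq> 0"
        by (auto simp: add_eq_0_iff)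
      then show ?case
        by (simp add: powr_def mult_ac flip: exp_of_nat_mult)
    qed
  qed auto
  finally show ?thesis .
qed

section \<open>The identity near 0 and the radius of convergence\<close>

text \<open>Lagrange's expansion for \<open>exp (t * z)\<close> and
  \<open>(1 + t) powr \<beta>\<close> on the unit disc, where \<open>1 + t\<close> avoids the cut.
  The factor \<open>(1 + x) powr \<beta>\<close> cancels from the quotient.\<close>

lemma kummer_series_near_0:
  "\<forall>\<^sub>F x in nhds 0. (\<lambda>n. kummer_coeff \<beta> z n * (x * (x + 1) powr (- \<beta>)) ^ n) sums
     (- ((x + 1) * exp (x * z)) / (\<beta> * x - x - 1))"
proof -
  have *: "1 + x \<notin> \<real>\<^sub>\<le>\<^sub>0" if "x \<in> ball 0 1" for x :: complex
  proof -
    have "\<bar>Re x\<bar> < 1"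
      using that abs_Re_le_cmod[of x] by simp
    then show ?thesis
      by (auto simp: complex_nonpos_Reals_iff)
  qed
  have "\<forall>\<^sub>F x in nhds 0. x \<in> ball (0::complex) 1"
    by (intro eventually_nhds_in_open) auto
  moreover have "\<forall>\<^sub>F x in nhds 0.
      (\<lambda>n. (deriv ^^ n) (\<lambda>t. exp (t * z) * ((1 + t) powr \<beta>) ^ n) 0 / fact n *
        (x / (1 + x) powr \<beta>) ^ n) sums
      (exp (x * z) * (1 + x) powr \<beta> / ((1 + x) powr \<beta> - x * deriv (\<lambda>x. (1 + x) powr \<beta>) x))"
    using * by (intro Lagrange_inversion[of "ball 0 1"] holomorphic_intros) auto
  ultimately show ?thesis
  proof eventually_elim
    case (elim x)
    define d where "d = \<beta> * x - x - 1"
    have x: "1 + x \<noteq> 0"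
      using *[OF elim(1)] by auto
    have "deriv (\<lambda>x. (1 + x) powr \<beta>) x = \<beta> * (1 + x) powr (\<beta> - 1)"
      using *[OF elim(1)] by (intro DERIV_imp_deriv) (auto intro!: derivative_eq_intros)
    also have "\<dots> = (1 + x) powr \<beta> * (\<beta> / (1 + x))"
      using x by (simp add: powr_diff)
    finally have "(1 + x) powr \<beta> - x * deriv (\<lambda>x. (1 + x) powr \<beta>) x =
        (1 + x) powr \<beta> * (- d / (1 + x))"
      using x by (simp add: d_def field_simps)
    then have "exp (x * z) * (1 + x) powr \<beta> / ((1 + x) powr \<beta> - x * deriv (\<lambda>x. (1 + x) powr \<beta>) x) =
        - ((x + 1) * exp (x * z)) / d"
      using x by (simp add: add.commute mult.commute)
    moreover have "x / (1 + x) powr \<beta> = x * (x + 1) powr (- \<beta>)"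
      by (simp add: powr_minus add.commute divide_inverse)
    ultimately show ?case
      using elim(2) by (simp only: kummer_coeff_conv_deriv d_def)
  qed
qed

text \<open>Convergence at a single nonzero value of \<open>x * (x + 1) powr (- \<beta>)\<close>
  suffices, and every small \<open>x \<noteq> 0\<close> provides one.\<close>

lemma conv_radius_kummer_coeff_pos: "conv_radius (kummer_coeff \<beta> z) > 0"
proof -
  have "\<forall>\<^sub>F x in at 0. x \<in> - {-1::complex} - {0}"
    by (intro eventually_at_in_open) auto
  moreover have "\<forall>\<^sub>F x in at 0. summable (\<lambda>n. kummer_coeff \<beta> z n * (x * (x + 1) powr (- \<beta>)) ^ n)"
    using kummer_series_near_0[of \<beta> z]
    by (auto simp: eventually_nhds_conv_at sums_iff elim: eventually_mono)
  ultimately have "\<forall>\<^sub>F x in at (0::complex). conv_radius (kummer_coeff \<beta> z) > 0"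
  proof eventually_elim
    case (elim x)
    then have "x * (x + 1) powr (- \<beta>) \<noteq> 0"
      by (auto simp: add_eq_0_iff2)
    then have "0 < ereal (norm (x * (x + 1) powr (- \<beta>)))"
      by (metis ereal_less(2) zero_less_norm_iff)
    also have "\<dots> \<le> conv_radius (kummer_coeff \<beta> z)"
      using elim(2) by (rule conv_radius_geI)
    finally show ?case .
  qed
  \<comment> \<open>The inequality does not depend on \<open>x\<close>, and the filter
    \<open>at 0\<close> is nontrivial.\<close>
  then show ?thesis
    by simp
qed

section \<open>Analytic continuation to the whole component\<close>

text \<open>The limit statement justifies the values chosen at singular parameters, and the
  nonvanishing of the denominator ensures that the quotient is a genuine one.\<close>

theorem proposition3p6:
  fixes \<beta> z :: complex
  shows "(\<forall>n. ((\<lambda>b. kummer_coeff_raw b z n) \<longlongrightarrow> kummer_coeff \<beta> z n) (at \<beta>)) \<and>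
         open (kummer_domain \<beta> z) \<and> 0 \<in> kummer_domain \<beta> z \<and>
         (\<forall>x \<in> kummer_domain \<beta> z.
           \<beta> * x - x - 1 \<noteq> 0 \<and>
           (\<lambda>n. kummer_coeff \<beta> z n * (x * (x + 1) powr (- \<beta>)) ^ n)
             sums (- ((x + 1) * exp (x * z)) / (\<beta> * x - x - 1)))"
proof -
  define w where "w = (\<lambda>x. x * (x + 1) powr (- \<beta>))"
  define R where "R = conv_radius (kummer_coeff \<beta> z)"
  define F where "F = Abs_fps (kummer_coeff \<beta> z)"
  define U where "U = {x :: complex. x \<noteq> -1 \<and> (\<beta> \<in> \<int> \<or> x + 1 \<notin> \<real>\<^sub>\<le>\<^sub>0)}"
  define D where "D = kummer_domain \<beta> z"
  have R: "fps_conv_radius F = R"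
    by (simp add: F_def R_def fps_conv_radius_def fps_nth_Abs_fps[abs_def])
  have "U = (if \<beta> \<in> \<int> then - {-1} else (\<lambda>x. x + 1) -` (- \<real>\<^sub>\<le>\<^sub>0))"
    by (auto simp: U_def)
  then have "open U"
    by (auto intro!: open_vimage continuous_intros)
  \<comment> \<open>For integral \<open>\<beta>\<close> the power is an integer power, holomorphic
    across the cut and away from -1; otherwise \<open>U\<close> is the slit plane of the principal
    branch.\<close>
  have hol_U: "w holomorphic_on U"
  proof (cases "\<beta> \<in> \<int>")
    case True
    then obtain m where "\<beta> = of_int m"
      by (auto elim: Ints_cases)
    then have "w = (\<lambda>x. x * (x + 1) powr of_int (- m))"
      by (simp add: w_def)
    moreover have "(\<lambda>x. x * (x + 1) powr of_int (- m)) holomorphic_on U"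
      by (intro holomorphic_intros) (auto simp: U_def add_eq_0_iff2)
    ultimately show ?thesis
      by simp
  next
    case False
    then show ?thesis
      unfolding w_def by (intro holomorphic_intros) (auto simp: U_def)
  qed
  define V where "V = {x \<in> U. w x \<in> eball 0 R}"
  have D_eq: "D = connected_component_set V 0"
    by (auto simp: D_def kummer_domain_def V_def U_def w_def R_def conj_ac)
  have "V = U \<inter> w -` eball 0 R"
    by (auto simp: V_def)
  then have "open V"
    using continuous_open_preimage[OF holomorphic_on_imp_continuous_on[OF hol_U] \<open>open U\<close> open_eball]
    by simp
  have "0 \<in> V"
    using conv_radius_kummer_coeff_pos[of \<beta> z] by (auto simp: V_def U_def w_def R_def zero_ereal_def)
  have D: "open D" "connected D" "0 \<in> D" "D \<subseteq> V"
    using \<open>open V\<close> \<open>0 \<in> V\<close>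
    by (auto simp: D_eq open_connected_component connected_component_refl connected_component_in)
  have "w holomorphic_on D"
    using hol_U D(4) by (auto simp: V_def intro: holomorphic_on_subset)
  then have hol_F: "(\<lambda>x. eval_fps F (w x)) holomorphic_on D"
    using D(4) R by (intro holomorphic_on_compose_gen[of w D "eval_fps F" "eball 0 R", unfolded o_def]
        holomorphic_on_eval_fps) (auto simp: V_def)
  have "\<forall>\<^sub>F x in nhds 0. eval_fps F (w x) = - ((x + 1) * exp (x * z)) / (\<beta> * x - x - 1)"
    using kummer_series_near_0[of \<beta> z]
    by eventually_elim (simp add: eval_fps_def F_def w_def sums_iff)
  moreover have "\<forall>\<^sub>F x in nhds 0. \<beta> * x - x - 1 \<noteq> 0"
  proof (rule tendsto_imp_eventually_ne)
    show "((\<lambda>x. \<beta> * x - x - 1) \<longlongrightarrow> \<beta> * 0 - 0 - 1) (nhds 0)"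
      by (intro tendsto_intros filterlim_ident)
  qed auto
  \<comment> \<open>Clearing the denominator makes both sides holomorphic on all of \<open>D\<close>
    before its zeros there are excluded.\<close>
  ultimately have "\<forall>\<^sub>F x in nhds 0. eval_fps F (w x) * (\<beta> * x - x - 1) = - ((x + 1) * exp (x * z))"
    by eventually_elim simp
  then obtain B where B: "open B" "0 \<in> B"
      "\<And>x. x \<in> B \<Longrightarrow> eval_fps F (w x) * (\<beta> * x - x - 1) = - ((x + 1) * exp (x * z))"
    unfolding eventually_nhds by blast
  have eq: "eval_fps F (w x) * (\<beta> * x - x - 1) = - ((x + 1) * exp (x * z))" if "x \<in> D" for x
    using that
  \<comment> \<open>The identity theorem on the connected set \<open>D\<close>; the rotation moves
    the premise \<open>x \<in> D\<close> to the front for chaining.\<close>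
  proof (rule analytic_continuation_open[of "B \<inter> D" D, rotated -1])
    show "(\<lambda>x. eval_fps F (w x) * (\<beta> * x - x - 1)) holomorphic_on D"
      using hol_F by (intro holomorphic_intros)
    show "(\<lambda>x. - ((x + 1) * exp (x * z))) holomorphic_on D"
      by (intro holomorphic_intros)
  qed (use B D in auto)
  have "\<beta> * x - x - 1 \<noteq> 0 \<and>
      (\<lambda>n. kummer_coeff \<beta> z n * w x ^ n) sums (- ((x + 1) * exp (x * z)) / (\<beta> * x - x - 1))"
    if "x \<in> D" for x
  proof -
    have "x \<noteq> -1" "w x \<in> eball 0 R"
      using that D(4) by (auto simp: V_def U_def)
    \<comment> \<open>A zero would force \<open>(x + 1) * exp (x * z) = 0\<close>, contradicting
      \<open>x \<noteq> -1\<close>.\<close>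
    then have "\<beta> * x - x - 1 \<noteq> 0"
      using eq[OF that] by (auto simp: add_eq_0_iff2)
    moreover have "(\<lambda>n. kummer_coeff \<beta> z n * w x ^ n) sums eval_fps F (w x)"
      using sums_eval_fps[of "w x" F] \<open>w x \<in> eball 0 R\<close> R by (simp add: F_def)
    moreover have "eval_fps F (w x) = - ((x + 1) * exp (x * z)) / (\<beta> * x - x - 1)"
      using eq[OF that] \<open>\<beta> * x - x - 1 \<noteq> 0\<close> by (metis nonzero_eq_divide_eq)
    ultimately show ?thesis
      by metis
  qed
  moreover have "((\<lambda>b. kummer_coeff_raw b z n) \<longlongrightarrow> kummer_coeff \<beta> z n) (at \<beta>)" for n
    unfolding kummer_coeff_eq by (rule tendsto_kummer_coeff_raw)
  ultimately show ?thesis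
    using D by (auto simp: D_def w_def)
qed
end
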